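(* Let $F=\{f_i\}_{i=1}^N$ be a Parseval $K$-frame for $\mathcal{H}_n$, where $K$ is a positive semi-definite operator on $\mathcal{H}_n$. Let $L:=\max\{\|f_i\|\,\|K^\dagger f_i\|:1\le i\le N\}$, $I_1:=\{i:\|f_i\|\,\|K^\dagger f_i\|=L\}$, $I_2:=\{1,\dots,N\}\setminus I_1$, and $V_j:=\operatorname{span}\{f_i:i\in I_j\}$ for $j=1,2$. Suppose that $V_1\cap V_2=\{0\}$ and that $\{f_i\}_{i\in I_1}$ is linearly independent. Then the canonical $K$-dual $K^\dagger F=\{K^\dagger f_i\}_{i=1}^N$ is a $1$-erasure optimal $K$-dual of $F$ with respect to the operator norm. Moreover, if $N>n$, the collection of all $1$-erasure optimal $K$-duals of $F$ under the operator norm is uncountable.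
   Context: $\mathcal{H}_n$ is an $n$-dimensional Hilbert space (over $\mathbb{R}$ or $\mathbb{C}$), $n\ge1$. For a bounded operator $K$ on $\mathcal{H}_n$, a sequence $F=\{f_i\}_{i=1}^N\subset\mathcal{H}_n$ is a $K$-frame if there are constants $0<A\le B<\infty$ with $A\|K^*f\|^2\le\sum_{i=1}^N|\langle f,f_i\rangle|^2\le B\|f\|^2$ for all $f$; it is a Parseval $K$-frame if $\sum_{i=1}^N|\langle f,f_i\rangle|^2=\|K^*f\|^2$ for all $f$. A sequence $G=\{g_i\}_{i=1}^N\subset\mathcal{H}_n$ is a $K$-dual of $F$ if $Kf=\sum_{i=1}^N\langle f,g_i\rangle f_i$ for all $f\in\mathcal{H}_n$. $K^\dagger$ is the Moore–Penrose pseudoinverse of $K$; for a Parseval $K$-frame $F$, $\{K^\dagger f_i\}_{i=1}^N$ is a $K$-dual, called the canonical $K$-dual. For a $K$-dual $G$ of $F$, $\mathbb{O}_1(F,G):=\max_{1\le i\le N}\|f_i\|\,\|g_i\|$ (the maximum operator norm of the error operators $f\mapsto\langle f,f_i\rangle g_i$). A $K$-dual $G'$ of $F$ is $1$-erasure optimal with respect to the operator norm if $\mathbb{O}_1(F,G')=\inf\{\mathbb{O}_1(F,G):G\text{ is a }K\text{-dual of }F\}$. *)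

theory Defs
  imports "HOL-Analysis.Analysis" "Jordan_Normal_Form.Conjugate"
begin

(* A common treatment of real and complex scalars.  The two axioms characterise the real and
   the complex field; see the instances and the lemma real_or_complex_cases below. *)
class real_or_complex = conjugatable_field + real_normed_field +
  assumes add_conjugate: "\<exists>r. a + conjugate a = r *\<^sub>R 1"
    and mult_conjugate_norm: "a * conjugate a = (norm a)\<^sup>2 *\<^sub>R 1"

lemma add_conjugate_Reals: "a + conjugate a \<in> range (of_real :: real \<Rightarrow> 'k::real_or_complex)"
  using add_conjugate[of a] by (auto simp: of_real_def)

lemma mult_conjugate: "a * conjugate a = of_real ((norm (a :: 'k::real_or_complex))\<^sup>2)"
  unfolding of_real_def by (rule mult_conjugate_norm)

instance real :: real_or_complex
  by standard (auto simp: power2_eq_square abs_mult_self_eq)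

instance complex :: real_or_complex
proof
  fix a :: complex
  show "\<exists>r. a + conjugate a = r *\<^sub>R 1"
    by (auto simp: complex_eq_iff)
  show "a * conjugate a = (norm a)\<^sup>2 *\<^sub>R 1"
    by (simp add: scaleR_conv_of_real complex_norm_square del: of_real_power)
qed

lemma conjugate_of_real: "conjugate (of_real r) = (of_real r :: 'k::real_or_complex)"
proof (cases "r = 0")
  case False
  have "of_real r * conjugate (of_real r) = (of_real r * of_real r :: 'k)"
    using mult_conjugate[of "of_real r :: 'k"] by (simp add: power2_eq_square flip: of_real_mult)
  then show ?thesis using False by simp
qed simp

lemma real_or_complex_cases:
  "range of_real = (UNIV :: 'k::real_or_complex set) \<or>
   (\<exists>i::'k. i * i = -1 \<and> conjugate i = - i \<and> (\<forall>z. \<exists>x y. z = of_real x + of_real y * i))"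
proof (cases "range of_real = (UNIV :: 'k set)")
  case False
  have real: "z \<in> range of_real" if "conjugate z = z" for z :: 'k
  proof -
    obtain r where "z + conjugate z = of_real r" using add_conjugate_Reals[of z] by blast
    then have "z = of_real (r / 2)" using that by (simp add: field_simps)
    then show ?thesis by blast
  qed
  have skew: "conjugate (z - conjugate z) = - (z - conjugate z)" for z :: 'k
    using conjugate_dist_add[of z "- conjugate z"] by (simp add: conjugate_neg)
  obtain z :: 'k where z: "z \<notin> range of_real" using False by blast
  define w where "w = z - conjugate z"
  have w: "w \<noteq> 0" "conjugate w = - w"
    using real[of z] z skew[of z] by (auto simp: w_def)
  define i where "i = of_real (1 / norm w) * w"
  have ci: "conjugate i = - i"
    unfolding i_def conjugate_dist_mul conjugate_of_real w(2) by simp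
  have "norm i = 1" using w(1) by (simp add: i_def norm_divide)
  then have ii: "i * i = -1" using mult_conjugate[of i] ci
    by (metis minus_equation_iff mult_minus_right of_real_1 power_one)
  have "\<exists>x y. v = of_real x + of_real y * i" for v :: 'k
  proof -
    define u where "u = v - conjugate v"
    have "conjugate u = - u" unfolding u_def by (rule skew)
    then have "conjugate (u * i) = u * i" by (simp add: conjugate_dist_mul ci)
    then obtain r where r: "u * i = of_real r" using real by fast
    have "u = - (u * i) * i" using ii by (simp add: mult.assoc)
    then have u: "u = - of_real r * i" using r by simp
    obtain s where s: "v + conjugate v = of_real s" using add_conjugate_Reals[of v] by blast
    have "v + v = of_real s + u" using s by (simp add: u_def algebra_simps)
    then have "v = of_real (s / 2) + of_real (- r / 2) * i"
      by (simp add: u field_simps)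
    then show ?thesis by blast
  qed
  then show ?thesis using ci ii by blast
qed simp

(* The inner product is linear in its first argument.  Completeness is automatic in finite
   dimension, and so is boundedness of linear operators. *)
locale finite_dim_hilbert_space = vector_space smul
  for smul :: "'k::real_or_complex \<Rightarrow> 'a::ab_group_add \<Rightarrow> 'a" +
  fixes ip :: "'a \<Rightarrow> 'a \<Rightarrow> 'k"
  assumes ip_add_left: "ip (x + y) z = ip x z + ip y z"
    and ip_scale_left: "ip (smul c x) z = c * ip x z"
    and ip_conjugate: "ip y x = conjugate (ip x y)"
    and ip_nonneg: "\<exists>r\<ge>0. ip x x = of_real r"
    and ip_eq_0: "ip x x = 0 \<Longrightarrow> x = 0"
    and finite_spanning: "\<exists>B. finite B \<and> span B = UNIV"

lemma finite_dim_hilbert_space_real: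
  "finite_dim_hilbert_space scaleR (inner :: 'a::euclidean_space \<Rightarrow> 'a \<Rightarrow> real)"
proof -
  interpret vector_space "scaleR :: real \<Rightarrow> 'a \<Rightarrow> 'a" by (rule real_vector.vector_space_axioms)
  show ?thesis
    by unfold_locales
      (auto simp: inner_add_left inner_add_right inner_commute span_raw_def[symmetric] intro!: exI[of _ Basis])
qed

lemma finite_dim_hilbert_space_complex:
  "finite_dim_hilbert_space (*s) (\<lambda>x y :: complex ^ 'n. \<Sum>i\<in>UNIV. x $ i * cnj (y $ i))"
proof
  fix x y z :: "complex ^ 'n" and c :: complex
  have sq: "(\<Sum>i\<in>UNIV. x $ i * cnj (x $ i)) = of_real (\<Sum>i\<in>UNIV. (norm (x $ i))\<^sup>2)"
    by (simp only: complex_norm_square of_real_sum)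
  show "(\<Sum>i\<in>UNIV. (x + y) $ i * cnj (z $ i)) =
      (\<Sum>i\<in>UNIV. x $ i * cnj (z $ i)) + (\<Sum>i\<in>UNIV. y $ i * cnj (z $ i))"
    by (simp add: distrib_right sum.distrib)
  show "(\<Sum>i\<in>UNIV. (c *s x) $ i * cnj (z $ i)) = c * (\<Sum>i\<in>UNIV. x $ i * cnj (z $ i))"
    by (simp add: sum_distrib_left mult.assoc)
  show "(\<Sum>i\<in>UNIV. y $ i * cnj (x $ i)) = conjugate (\<Sum>i\<in>UNIV. x $ i * cnj (y $ i))"
    by (simp add: mult.commute)
  show "\<exists>r\<ge>0. (\<Sum>i\<in>UNIV. x $ i * cnj (x $ i)) = of_real r"
    using sq sum_nonneg[of UNIV "\<lambda>i. (norm (x $ i))\<^sup>2"] by auto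
  show "x = 0" if "(\<Sum>i\<in>UNIV. x $ i * cnj (x $ i)) = 0"
  proof -
    have "(\<Sum>i\<in>UNIV. (norm (x $ i))\<^sup>2) = 0" using that sq by (metis of_real_eq_0_iff)
    then show ?thesis by (simp add: sum_nonneg_eq_0_iff vec_eq_iff)
  qed
  show "\<exists>B. finite B \<and> vec.span B = (UNIV :: (complex ^ 'n) set)"
    using vec.finite_Basis vec.span_Basis by blast
qed

definition ip_norm :: "('a \<Rightarrow> 'a \<Rightarrow> 'k::real_or_complex) \<Rightarrow> 'a \<Rightarrow> real" where
  "ip_norm ip x = sqrt (norm (ip x x))"

definition adj ::
  "('a \<Rightarrow> 'a \<Rightarrow> 'k::real_or_complex) \<Rightarrow> ('a \<Rightarrow> 'a) \<Rightarrow> 'a \<Rightarrow> 'a" where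
  "adj ip T = (THE T'. \<forall>x y. ip (T x) y = ip x (T' y))"

definition self_adjoint :: "('a \<Rightarrow> 'a \<Rightarrow> 'k::real_or_complex) \<Rightarrow> ('a \<Rightarrow> 'a) \<Rightarrow> bool" where
  "self_adjoint ip T \<longleftrightarrow> (\<forall>x y. ip (T x) y = ip x (T y))"

(* Self-adjointness is part of the definition because it does not follow from the
   second condition over the reals. *)
definition positive_semidefinite ::
  "('k::real_or_complex \<Rightarrow> 'a::ab_group_add \<Rightarrow> 'a) \<Rightarrow> ('a \<Rightarrow> 'a \<Rightarrow> 'k) \<Rightarrow> ('a \<Rightarrow> 'a) \<Rightarrow> bool" where
  "positive_semidefinite smul ip T \<longleftrightarrow>
     Vector_Spaces.linear smul smul T \<and> self_adjoint ip T \<and>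
     (\<forall>x. \<exists>r\<ge>0. ip (T x) x = of_real r)"

(* The unique solution of the four Penrose equations. *)
definition pseudoinverse ::
  "('k::real_or_complex \<Rightarrow> 'a::ab_group_add \<Rightarrow> 'a) \<Rightarrow> ('a \<Rightarrow> 'a \<Rightarrow> 'k) \<Rightarrow> ('a \<Rightarrow> 'a) \<Rightarrow> 'a \<Rightarrow> 'a" where
  "pseudoinverse smul ip T = (THE P. Vector_Spaces.linear smul smul P \<and>
     T \<circ> P \<circ> T = T \<and> P \<circ> T \<circ> P = P \<and> self_adjoint ip (T \<circ> P) \<and> self_adjoint ip (P \<circ> T))"

(* A sequence of N vectors is a function on a finite index type with N elements, so that two
   sequences are equal iff they agree at all N indices.  Parseval implies the two-sided
   frame inequality, with A = 1. *)
definition parseval_K_frame ::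
  "('a \<Rightarrow> 'a \<Rightarrow> 'k::real_or_complex) \<Rightarrow> ('a \<Rightarrow> 'a) \<Rightarrow> ('i::finite \<Rightarrow> 'a) \<Rightarrow> bool" where
  "parseval_K_frame ip K f \<longleftrightarrow>
     (\<forall>x. (\<Sum>i\<in>UNIV. (norm (ip x (f i)))\<^sup>2) = (ip_norm ip (adj ip K x))\<^sup>2)"

definition K_dual ::
  "('k::real_or_complex \<Rightarrow> 'a::ab_group_add \<Rightarrow> 'a) \<Rightarrow> ('a \<Rightarrow> 'a \<Rightarrow> 'k) \<Rightarrow> ('a \<Rightarrow> 'a) \<Rightarrow>
   ('i::finite \<Rightarrow> 'a) \<Rightarrow> ('i \<Rightarrow> 'a) \<Rightarrow> bool" where
  "K_dual smul ip K f g \<longleftrightarrow> (\<forall>x. K x = (\<Sum>i\<in>UNIV. smul (ip x (g i)) (f i)))"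

definition canonical_K_dual ::
  "('k::real_or_complex \<Rightarrow> 'a::ab_group_add \<Rightarrow> 'a) \<Rightarrow> ('a \<Rightarrow> 'a \<Rightarrow> 'k) \<Rightarrow> ('a \<Rightarrow> 'a) \<Rightarrow>
   ('i::finite \<Rightarrow> 'a) \<Rightarrow> 'i \<Rightarrow> 'a" where
  "canonical_K_dual smul ip K f = (\<lambda>i. pseudoinverse smul ip K (f i))"

definition erasure_error ::
  "('a \<Rightarrow> 'a \<Rightarrow> 'k::real_or_complex) \<Rightarrow> ('i::finite \<Rightarrow> 'a) \<Rightarrow> ('i \<Rightarrow> 'a) \<Rightarrow> real" where
  "erasure_error ip f g = Max (range (\<lambda>i. ip_norm ip (f i) * ip_norm ip (g i)))"

definition one_erasure_optimal ::
  "('k::real_or_complex \<Rightarrow> 'a::ab_group_add \<Rightarrow> 'a) \<Rightarrow> ('a \<Rightarrow> 'a \<Rightarrow> 'k) \<Rightarrow> ('a \<Rightarrow> 'a) \<Rightarrow>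
   ('i::finite \<Rightarrow> 'a) \<Rightarrow> ('i \<Rightarrow> 'a) \<Rightarrow> bool" where
  "one_erasure_optimal smul ip K f g \<longleftrightarrow> K_dual smul ip K f g \<and>
     erasure_error ip f g = Inf {erasure_error ip f h | h. K_dual smul ip K f h}"

(* Independence of an indexed family: repeated vectors count as dependent. *)
definition independent_family ::
  "('k::real_or_complex \<Rightarrow> 'a::ab_group_add \<Rightarrow> 'a) \<Rightarrow> ('i \<Rightarrow> 'a) \<Rightarrow> 'i set \<Rightarrow> bool" where
  "independent_family smul f I \<longleftrightarrow> inj_on f I \<and> \<not> module.dependent smul (f ` I)"

end

theory Submission
  imports Defs
begin

text \<open>
  A second \<open>K\<close>-dual of \<open>f\<close> differs from a first one, say \<open>p\<close>, by vectors \<open>h i\<close> for which the scalars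
  \<open>ip x (h i)\<close> are, for every \<open>x\<close>, the coefficients of a linear relation among the \<open>f i\<close>. The two
  hypotheses on \<open>V1\<close> and \<open>V2\<close> force every such relation to vanish on \<open>I1\<close>: its two halves, over \<open>I1\<close>
  and \<open>I2\<close>, are opposite vectors of \<open>V1\<close> and \<open>V2\<close>, so both are zero, and the first half is a
  relation in an independent family (\<open>relation_zero_on_independent_part\<close>). Hence all \<open>K\<close>-duals agree
  on \<open>I1\<close> (\<open>K_dual_eq_on_independent_part\<close>). The canonical dual attains its error \<open>L\<close> at an index of
  \<open>I1\<close>, so every dual has error at least \<open>L\<close>, which is the optimality.

  If there are more than \<open>n\<close> frame vectors, some relation with coefficients \<open>c\<close> is nontrivial. It
  vanishes on \<open>I1\<close>, so adding the multiples \<open>t * conjugate (c i)\<close> of a fixed nonzero vector to the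
  canonical dual (\<open>K_dual_perturb\<close>) changes it only on \<open>I2\<close>. There the error is strictly below \<open>L\<close>
  and stays so for small real \<open>t\<close> by continuity; different \<open>t\<close> give different optimal duals.

  That the canonical dual is a \<open>K\<close>-dual at all comes from two facts about the self-adjoint operator
  \<open>K\<close>: the Parseval identity says that the frame operator is the square of \<open>K\<close>
  (\<open>parseval_frame_operator\<close>), and the pseudoinverse \<open>P\<close> of \<open>K\<close> is self-adjoint with
  \<open>K (K (P x)) = K x\<close> (\<open>pseudoinverse_self_adjoint\<close>).
\<close>

context finite_dim_hilbert_space
begin

section \<open>Inner products over a common scalar field\<close>

lemma ip_add_right: "ip z (x + y) = ip z x + ip z y"
  using ip_conjugate[of z "x + y"] ip_conjugate[of z x] ip_conjugate[of z y]
  by (metis ip_add_left conjugate_dist_add conjugate_id ip_conjugate)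

lemma ip_scale_right: "ip z (smul c x) = conjugate c * ip z x"
  by (metis ip_scale_left conjugate_dist_mul ip_conjugate)

lemma ip_zero_left [simp]: "ip 0 x = 0"
  using ip_add_left[of 0 0 x] by simp

lemma ip_zero_right [simp]: "ip x 0 = 0"
  using ip_add_right[of x 0 0] by simp

lemma ip_minus_left: "ip (- x) y = - ip x y"
  using ip_add_left[of x "- x" y] by (simp add: eq_neg_iff_add_eq_0 add.commute)

lemma ip_minus_right: "ip y (- x) = - ip y x"
  using ip_add_right[of y x "- x"] by (simp add: eq_neg_iff_add_eq_0 add.commute)

lemma ip_diff_left: "ip (x - y) z = ip x z - ip y z"
  using ip_add_left[of x "- y" z] by (simp add: ip_minus_left)

lemma ip_diff_right: "ip z (x - y) = ip z x - ip z y"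
  using ip_add_right[of z x "- y"] by (simp add: ip_minus_right)

lemma ip_sum_left: "ip (\<Sum>i\<in>A. v i) z = (\<Sum>i\<in>A. ip (v i) z)"
  by (induction A rule: infinite_finite_induct) (auto simp: ip_add_left)

lemma ip_sum_right: "ip z (\<Sum>i\<in>A. v i) = (\<Sum>i\<in>A. ip z (v i))"
  by (induction A rule: infinite_finite_induct) (auto simp: ip_add_right)

lemma ip_eqI:
  assumes "\<And>x. ip x y = ip x z"
  shows "y = z"
  using ip_eq_0[of "y - z"] assms by (simp add: ip_diff_right)

lemma ip_self_eq_of_real_norm: "ip x x = of_real (norm (ip x x))"
  using ip_nonneg[of x] by auto

lemma of_real_ip_norm_power2: "of_real ((ip_norm ip x)\<^sup>2) = ip x x"
  using ip_self_eq_of_real_norm[of x] by (simp add: ip_norm_def)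

section \<open>Self-adjoint operators and their pseudoinverse\<close>

lemma adj_self_adjoint:
  assumes "self_adjoint ip T"
  shows "adj ip T = T"
  unfolding adj_def
proof (rule the_equality)
  show "\<forall>x y. ip (T x) y = ip x (T y)" using assms by (simp add: self_adjoint_def)
  fix T' assume "\<forall>x y. ip (T x) y = ip x (T' y)"
  then show "T' = T" using assms by (intro ext ip_eqI) (simp add: self_adjoint_def)
qed

text \<open>For a general operator this fails over the reals and needs the imaginary unit over the complex
  numbers. For a self-adjoint one a single expansion serves both fields: the form at \<open>x + T x\<close> is
  \<open>2 * ip (T x) (T x)\<close>.\<close>

lemma self_adjoint_form_zero:
  assumes sa: "self_adjoint ip T" and add: "\<And>x y. T (x + y) = T x + T y"
    and form: "\<And>x. ip (T x) x = 0"
  shows "T x = 0"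
proof -
  have "0 = ip (T (x + T x)) (x + T x)" using form by simp
  also have "\<dots> = ip (T x) (T x) + ip (T (T x)) x"
    by (simp add: add ip_add_left ip_add_right form)
  also have "ip (T (T x)) x = ip (T x) (T x)" using sa by (simp add: self_adjoint_def)
  finally have "2 * ip (T x) (T x) = 0" unfolding mult_2 by (rule sym)
  then show ?thesis using ip_eq_0 by simp
qed

lemma self_adjoint_kernel_power2:
  assumes "self_adjoint ip T" and "T (T x) = 0"
  shows "T x = 0"
  using assms ip_eq_0[of "T x"] by (metis ip_zero_right self_adjoint_def)

lemma self_adjoint_square_inj:
  assumes lin: "Vector_Spaces.linear smul smul T" and sa: "self_adjoint ip T"
    and eq: "T (T x) = T (T y)"
  shows "T x = T y"
proof -
  interpret T: Vector_Spaces.linear smul smul T by (rule lin)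
  have "T (T (x - y)) = 0" using eq by (simp add: T.diff)
  then have "T (x - y) = 0" by (rule self_adjoint_kernel_power2[OF sa])
  then show ?thesis by (simp add: T.diff)
qed

text \<open>A self-adjoint operator is injective on its range because its square has the same kernel; in
  finite dimension it therefore maps its range onto itself.\<close>

lemma self_adjoint_range_square:
  assumes lin: "Vector_Spaces.linear smul smul T" and sa: "self_adjoint ip T"
  shows "\<exists>w. T (T w) = T x"
proof -
  obtain S where S: "finite S" "span S = UNIV" using finite_spanning by blast
  obtain B where B: "B \<subseteq> S" "independent B" "S \<subseteq> span B"
    using maximal_independent_subset[of S] by blast
  have "span S \<subseteq> span B" using B(3) by (simp add: span_minimal)
  then have "span B = UNIV" using S(2) by blast
  then interpret fd: finite_dimensional_vector_space smul B
    using B S(1) by unfold_locales (auto intro: finite_subset)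
  interpret fdp: finite_dimensional_vector_space_pair smul B smul B by unfold_locales
  interpret T: Vector_Spaces.linear smul smul T by (rule lin)
  have sub: "subspace (range T)" by (simp add: T.subspace_image)
  then have "span (range T) = range T" by simp
  moreover have "inj_on T (range T)"
    by (auto intro!: inj_onI dest: self_adjoint_square_inj[OF lin sa])
  ultimately have inj: "inj_on T (span (range T))" by (simp only:)
  have "T ` range T = range T"
    using fdp.dim_image_eq[OF lin inj] sub
    by (intro fd.subspace_dim_equal T.subspace_image) auto
  then have "T x \<in> T ` range T" by blast
  then show ?thesis by auto
qed

text \<open>Inserting one solution into the other turns \<open>T \<circ> P\<close> into \<open>T \<circ> Q \<circ> T \<circ> P\<close>; moving the two
  self-adjoint factors across the inner product reverses their order, and the product then collapses
  to \<open>T \<circ> Q\<close>. The same works for \<open>P \<circ> T\<close>.\<close>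

lemma penrose_unique:
  assumes P: "T \<circ> P \<circ> T = T" "P \<circ> T \<circ> P = P" "self_adjoint ip (T \<circ> P)" "self_adjoint ip (P \<circ> T)"
    and Q: "T \<circ> Q \<circ> T = T" "Q \<circ> T \<circ> Q = Q" "self_adjoint ip (T \<circ> Q)" "self_adjoint ip (Q \<circ> T)"
  shows "P = Q"
proof -
  have eqs: "T (P (T z)) = T z" "T (Q (T z)) = T z" "P (T (P z)) = P z" "Q (T (Q z)) = Q z" for z
    using P(1,2) Q(1,2) by (simp_all add: fun_eq_iff)
  have sP: "ip (T (P u)) v = ip u (T (P v))" "ip (P (T u)) v = ip u (P (T v))" for u v
    using P(3,4) by (simp_all add: self_adjoint_def)
  have sQ: "ip (T (Q u)) v = ip u (T (Q v))" "ip (Q (T u)) v = ip u (Q (T v))" for u v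
    using Q(3,4) by (simp_all add: self_adjoint_def)
  have TPQ: "T (P y) = T (Q y)" for y
  proof (rule ip_eqI)
    fix x
    have "ip x (T (P y)) = ip (T (P x)) y" by (rule sP(1)[symmetric])
    also have "\<dots> = ip (T (Q (T (P x)))) y" by (simp only: eqs)
    also have "\<dots> = ip x (T (P (T (Q y))))" by (simp only: sP sQ)
    also have "\<dots> = ip x (T (Q y))" by (simp only: eqs)
    finally show "ip x (T (P y)) = ip x (T (Q y))" .
  qed
  have PQT: "P (T y) = Q (T y)" for y
  proof (rule ip_eqI)
    fix x
    have "ip x (P (T y)) = ip x (P (T (Q (T y))))" by (simp only: eqs)
    also have "\<dots> = ip (Q (T (P (T x)))) y" by (simp only: sP sQ)
    also have "\<dots> = ip (Q (T x)) y" by (simp only: eqs)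
    also have "\<dots> = ip x (Q (T y))" by (rule sQ(2))
    finally show "ip x (P (T y)) = ip x (Q (T y))" .
  qed
  show ?thesis
  proof
    fix x
    have "P x = P (T (P x))" by (simp only: eqs)
    also have "\<dots> = Q (T (Q x))" by (simp only: PQT TPQ)
    also have "\<dots> = Q x" by (simp only: eqs)
    finally show "P x = Q x" .
  qed
qed

text \<open>A self-adjoint operator is invertible on its range, and its pseudoinverse is that inverse after
  the orthogonal projection to the range. So it sends \<open>x\<close> to the unique \<open>z\<close> in the range with
  \<open>T (T z) = T x\<close>, and uniqueness of \<open>z\<close> gives linearity, commutation with \<open>T\<close> and the first
  two Penrose equations. Self-adjointness follows from \<open>T\<close> times the inverse being the orthogonal
  projection.\<close>

lemma pseudoinverse_self_adjoint:
  assumes lin: "Vector_Spaces.linear smul smul T" and sa: "self_adjoint ip T"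
  shows "self_adjoint ip (pseudoinverse smul ip T)"
    and "T (T (pseudoinverse smul ip T x)) = T x"
proof -
  interpret T: Vector_Spaces.linear smul smul T by (rule lin)
  have "\<exists>z. z \<in> range T \<and> T (T z) = T x" for x
    by (metis self_adjoint_range_square[OF lin sa] rangeI)
  then obtain P where Pr: "\<And>x. P x \<in> range T" and P2: "\<And>x. T (T (P x)) = T x" by metis
  have inj: "u = v" if "u \<in> range T" "v \<in> range T" "T u = T v" for u v
    using that self_adjoint_square_inj[OF lin sa] by blast
  have uniq: "P x = z" if "z \<in> range T" "T (T z) = T x" for x z
    using that Pr P2 inj by (metis rangeI)
  have sT: "ip (T u) v = ip u (T v)" for u v using sa by (simp add: self_adjoint_def)
  have sub: "subspace (range T)" by (simp add: T.subspace_image)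
  have linP: "Vector_Spaces.linear smul smul P"
  proof (intro Vector_Spaces.linear_iff[THEN iffD2] conjI allI)
    fix x y c
    show "P (x + y) = P x + P y"
      by (intro uniq subspace_add[OF sub] Pr) (simp add: T.add P2)
    show "P (smul c x) = smul c (P x)"
      by (intro uniq subspace_scale[OF sub] Pr) (simp add: T.scale P2)
  qed (unfold_locales)
  have comm: "P (T x) = T (P x)" for x
    by (rule uniq) (simp_all add: P2)
  have TPT: "T (P (T x)) = T x" for x by (simp add: comm P2)
  have PTP: "P (T (P x)) = P x" for x
    by (rule inj) (simp_all add: Pr TPT)
  \<comment> \<open>\<open>T \<circ> P\<close> is the orthogonal projection to the range, which contains \<open>P x\<close>.\<close>
  have proj: "ip (P x) (T (P y)) = ip (P x) y" for x y
  proof -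
    obtain w where "P x = T w" using Pr[of x] by blast
    then show ?thesis by (simp add: sT P2)
  qed
  have sa_P: "self_adjoint ip P"
    unfolding self_adjoint_def
  proof (intro allI)
    fix x y
    have "ip (P x) y = ip (T (P x)) (P y)" by (simp add: sT proj)
    also have "\<dots> = conjugate (ip (P y) (T (P x)))" by (rule ip_conjugate)
    also have "\<dots> = ip x (P y)" by (simp only: proj ip_conjugate[symmetric])
    finally show "ip (P x) y = ip x (P y)" .
  qed
  have saTP: "self_adjoint ip (T \<circ> P)"
    using sa_P by (simp add: self_adjoint_def sT comm)
  have pinv: "pseudoinverse smul ip T = P"
    unfolding pseudoinverse_def
  proof (rule the_equality)
    show "Vector_Spaces.linear smul smul P \<and> T \<circ> P \<circ> T = T \<and> P \<circ> T \<circ> P = P \<and>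
        self_adjoint ip (T \<circ> P) \<and> self_adjoint ip (P \<circ> T)" (is "?penrose P")
      using linP saTP comm TPT PTP by (simp add: fun_eq_iff self_adjoint_def)
    fix Q assume "?penrose Q"
    with \<open>?penrose P\<close> show "Q = P" by (blast intro: penrose_unique)
  qed
  show "self_adjoint ip (pseudoinverse smul ip T)" using sa_P pinv by simp
  show "T (T (pseudoinverse smul ip T x)) = T x" using P2 pinv by simp
qed

section \<open>Parseval frames and their canonical duals\<close>

text \<open>The Parseval identity compares only the quadratic forms of the frame operator and of
  \<open>K \<circ> K\<close>; their difference is self-adjoint, so equality of the forms is enough.\<close>

lemma parseval_frame_operator:
  fixes f :: "'i::finite \<Rightarrow> 'a"
  assumes lin: "Vector_Spaces.linear smul smul K" and sa: "self_adjoint ip K"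
    and parseval: "parseval_K_frame ip K f"
  shows "(\<Sum>i\<in>UNIV. smul (ip x (f i)) (f i)) = K (K x)"
proof -
  interpret K: Vector_Spaces.linear smul smul K by (rule lin)
  define T where "T x = (\<Sum>i\<in>UNIV. smul (ip x (f i)) (f i)) - K (K x)" for x
  have sK: "ip (K u) v = ip u (K v)" for u v using sa by (simp add: self_adjoint_def)
  have form: "ip (T x) y = (\<Sum>i\<in>UNIV. ip x (f i) * conjugate (ip y (f i))) - ip (K x) (K y)" for x y
    by (simp add: T_def ip_diff_left ip_sum_left ip_scale_left sK ip_conjugate[symmetric])
  have "T x = 0"
  proof (rule self_adjoint_form_zero[of T])
    have "ip x (T y) = ip (T x) y" for x y
      by (simp add: T_def ip_diff_left ip_diff_right ip_sum_left ip_sum_right ip_scale_left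
          ip_scale_right sK ip_conjugate[symmetric] mult.commute)
    then show "self_adjoint ip T" by (simp add: self_adjoint_def)
    show "T (x + y) = T x + T y" for x y
      by (simp add: T_def ip_add_left scale_left_distrib sum.distrib K.add)
    fix z
    have "(\<Sum>i\<in>UNIV. ip z (f i) * conjugate (ip z (f i)))
        = of_real (\<Sum>i\<in>UNIV. (norm (ip z (f i)))\<^sup>2)"
      by (simp only: mult_conjugate of_real_sum)
    also have "\<dots> = of_real ((ip_norm ip (K z))\<^sup>2)"
      using parseval by (simp only: parseval_K_frame_def adj_self_adjoint[OF sa])
    also have "\<dots> = ip (K z) (K z)" by (rule of_real_ip_norm_power2)
    finally show "ip (T z) z = 0" by (simp add: form)
  qed
  then show ?thesis by (simp add: T_def)
qed

text \<open>Moving the self-adjoint pseudoinverse \<open>P\<close> of \<open>K\<close> to the other side of the inner product turns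
  the reconstruction sum into the frame operator at \<open>P x\<close>, which is \<open>K (K (P x))\<close>.\<close>

lemma canonical_K_dual_is_K_dual:
  fixes f :: "'i::finite \<Rightarrow> 'a"
  assumes lin: "Vector_Spaces.linear smul smul K" and sa: "self_adjoint ip K"
    and parseval: "parseval_K_frame ip K f"
  shows "K_dual smul ip K f (canonical_K_dual smul ip K f)"
proof -
  let ?P = "pseudoinverse smul ip K"
  have "(\<Sum>i\<in>UNIV. smul (ip x (?P (f i))) (f i)) = K x" for x
  proof -
    have "ip x (?P (f i)) = ip (?P x) (f i)" for i
      using pseudoinverse_self_adjoint(1)[OF lin sa] by (simp add: self_adjoint_def)
    then show ?thesis
      using parseval_frame_operator[OF assms, of "?P x"] pseudoinverse_self_adjoint(2)[OF lin sa]
      by simp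
  qed
  then show ?thesis by (simp add: K_dual_def canonical_K_dual_def)
qed

section \<open>Linear relations among the frame vectors\<close>

lemma independent_family_relation_zero:
  assumes ind: "independent_family smul f I" and "finite I"
    and rel: "(\<Sum>i\<in>I. smul (c i) (f i)) = 0" and "i \<in> I"
  shows "c i = 0"
proof -
  have inj: "inj_on f I" and ind': "independent (f ` I)"
    using ind by (auto simp: independent_family_def)
  define u where "u = (\<lambda>v. c (the_inv_into I f v))"
  have u: "u (f j) = c j" if "j \<in> I" for j using inj that by (simp add: u_def the_inv_into_f_f)
  have "(\<Sum>v\<in>f ` I. smul (u v) v) = (\<Sum>i\<in>I. smul (c i) (f i))"
    by (simp add: sum.reindex[OF inj] u)
  then have "u (f i) = 0"
    using rel assms(2,4) by (intro independentD[OF ind', of "f ` I"]) auto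
  then show ?thesis using u assms(4) by simp
qed

text \<open>The two halves of the relation are opposite vectors, one in each of two spans that meet only
  in zero.\<close>

lemma relation_zero_on_independent_part:
  fixes f :: "'i::finite \<Rightarrow> 'a"
  assumes ind: "independent_family smul f I"
    and disj: "span (f ` I) \<inter> span (f ` (- I)) = {0}"
    and rel: "(\<Sum>i\<in>UNIV. smul (c i) (f i)) = 0" and "i \<in> I"
  shows "c i = 0"
proof -
  let ?s = "\<lambda>J. \<Sum>i\<in>J. smul (c i) (f i)"
  have mem: "?s J \<in> span (f ` J)" for J
    by (intro span_sum span_scale span_base) auto
  have "?s I + ?s (- I) = 0"
    using rel sum.union_disjoint[of I "- I" "\<lambda>i. smul (c i) (f i)"] by (simp add: Compl_partition)
  then have "?s I = - ?s (- I)" by (simp add: eq_neg_iff_add_eq_0)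
  then have "?s I \<in> span (f ` (- I))" using mem[of "- I"] span_neg by simp
  then have "?s I = 0" using mem[of I] disj by blast
  then show ?thesis using independent_family_relation_zero[OF ind _ _ \<open>i \<in> I\<close>] by simp
qed

lemma exists_relation_of_card_gt_dim:
  fixes f :: "'i::finite \<Rightarrow> 'a"
  assumes "dim (UNIV :: 'a set) < CARD('i)"
  obtains c j where "(\<Sum>i\<in>UNIV. smul (c i) (f i)) = 0" and "c j \<noteq> 0"
proof (cases "inj f")
  case False
  then obtain i j where ij: "i \<noteq> j" "f i = f j" by (auto simp: inj_on_def)
  define c :: "'i \<Rightarrow> 'k" where "c l = (if l = i then 1 else if l = j then -1 else 0)" for l
  have "(\<Sum>l\<in>UNIV. smul (c l) (f l)) = (\<Sum>l\<in>{i, j}. smul (c l) (f l))"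
    by (rule sum.mono_neutral_right) (auto simp: c_def)
  also have "\<dots> = 0" using ij by (simp add: c_def)
  finally show ?thesis using that[of c i] by (simp add: c_def)
next
  case True
  obtain S where S: "finite S" "span S = UNIV" using finite_spanning by blast
  have "dependent (range f)"
  proof (rule ccontr)
    assume "independent (range f)"
    then obtain B where B: "range f \<subseteq> B" "B \<subseteq> UNIV" "independent B" "UNIV \<subseteq> span B"
      by (rule maximal_independent_subset_extend[OF subset_UNIV])
    have "finite B" using independent_span_bound[OF S(1) B(3)] S(2) by simp
    then have "card (range f) \<le> card B" using B(1) by (rule card_mono)
    moreover have "card B = dim UNIV" using B(2-4) by (intro basis_card_eq_dim)
    ultimately show False using assms True by (simp add: card_image)
  qed
  then obtain u v where uv: "v \<in> range f" "u v \<noteq> 0" "(\<Sum>v\<in>range f. smul (u v) v) = 0"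
    unfolding dependent_finite[OF finite_imageI[OF finite, of f]] by blast
  then show ?thesis using that[of "u \<circ> f"] by (auto simp: sum.reindex[OF True])
qed

section \<open>Duals differ only off the independent part\<close>

lemma K_dual_eq_on_independent_part:
  fixes f :: "'i::finite \<Rightarrow> 'a"
  assumes ind: "independent_family smul f I"
    and disj: "span (f ` I) \<inter> span (f ` (- I)) = {0}"
    and g: "K_dual smul ip K f g" and h: "K_dual smul ip K f h" and "i \<in> I"
  shows "g i = h i"
proof (rule ip_eqI)
  fix x
  have "(\<Sum>i\<in>UNIV. smul (ip x (g i) - ip x (h i)) (f i)) = K x - K x"
    using g h unfolding K_dual_def by (simp add: scale_left_diff_distrib sum_subtractf)
  then show "ip x (g i) = ip x (h i)"
    using relation_zero_on_independent_part[OF ind disj, of "\<lambda>i. ip x (g i) - ip x (h i)" i] \<open>i \<in> I\<close>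
    by simp
qed

text \<open>The conjugate undoes the conjugate-linearity of the inner product in its second argument, so
  that the added term is a multiple of the given relation.\<close>

lemma K_dual_perturb:
  fixes f :: "'i::finite \<Rightarrow> 'a"
  assumes g: "K_dual smul ip K f g" and rel: "(\<Sum>i\<in>UNIV. smul (c i) (f i)) = 0"
  shows "K_dual smul ip K f (\<lambda>i. g i + smul (conjugate (c i)) v)"
proof -
  have "(\<Sum>i\<in>UNIV. smul (ip x (g i + smul (conjugate (c i)) v)) (f i))
      = (\<Sum>i\<in>UNIV. smul (ip x (g i)) (f i)) + smul (ip x v) (\<Sum>i\<in>UNIV. smul (c i) (f i))" for x
    by (simp add: ip_add_right ip_scale_right scale_left_distrib sum.distrib scale_sum_right mult.commute)
  then show ?thesis using g rel by (simp add: K_dual_def)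
qed

text \<open>Continuity along a line is read off the expansion of the squared norm as a polynomial in
  \<open>t\<close>.\<close>

lemma ip_norm_add_scale_tendsto:
  "((\<lambda>t. ip_norm ip (a + smul (of_real t) b)) \<longlongrightarrow> ip_norm ip a) (at_right 0)"
proof -
  have "ip (a + smul (of_real t) b) (a + smul (of_real t) b)
      = ip a a + of_real t * (ip a b + ip b a) + of_real t * (of_real t * ip b b)" for t
    by (simp add: ip_add_left ip_add_right ip_scale_left ip_scale_right conjugate_of_real algebra_simps)
  then show ?thesis
    unfolding ip_norm_def by (auto intro!: tendsto_eq_intros)
qed

end

theorem theorem4p2:
  fixes smul :: "'k::real_or_complex \<Rightarrow> 'a::ab_group_add \<Rightarrow> 'a"
    and ip :: "'a \<Rightarrow> 'a \<Rightarrow> 'k"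
    and K :: "'a \<Rightarrow> 'a"
    and f :: "'i::finite \<Rightarrow> 'a"
    and n N :: nat
    and L :: real
    and I1 I2 :: "'i set"
    and V1 V2 :: "'a set"
  assumes "finite_dim_hilbert_space smul ip"
    and "vector_space.dim smul (UNIV :: 'a set) = n" and "n \<ge> 1"
    and "N = CARD('i)"
    and "positive_semidefinite smul ip K"
    and "parseval_K_frame ip K f"
    and "L = Max (range (\<lambda>i. ip_norm ip (f i) * ip_norm ip (pseudoinverse smul ip K (f i))))"
    and "I1 = {i. ip_norm ip (f i) * ip_norm ip (pseudoinverse smul ip K (f i)) = L}"
    and "I2 = UNIV - I1"
    and "V1 = module.span smul (f ` I1)"
    and "V2 = module.span smul (f ` I2)"
    and "V1 \<inter> V2 = {0}"
    and "independent_family smul f I1"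
  shows "one_erasure_optimal smul ip K f (canonical_K_dual smul ip K f) \<and>
    (N > n \<longrightarrow> uncountable {g. one_erasure_optimal smul ip K f g})"
proof -
  interpret finite_dim_hilbert_space smul ip by fact
  have lin: "Vector_Spaces.linear smul smul K" and sa: "self_adjoint ip K"
    using assms(5) by (auto simp: positive_semidefinite_def)
  have disj: "span (f ` I1) \<inter> span (f ` (- I1)) = {0}"
    using assms(9-12) by (simp add: Compl_eq_Diff_UNIV)
  note ind = assms(13)
  define p where "p = canonical_K_dual smul ip K f"
  define e where "e g i = ip_norm ip (f i) * ip_norm ip (g i)" for g i
  have L: "L = Max (range (e p))" and I1: "I1 = {i. e p i = L}"
    using assms(7,8) by (simp_all add: e_def p_def canonical_K_dual_def)
  have err: "erasure_error ip f g = Max (range (e g))" for g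
    by (simp add: erasure_error_def e_def)
  have p: "K_dual smul ip K f p"
    unfolding p_def by (rule canonical_K_dual_is_K_dual[OF lin sa assms(6)])
  have "L \<in> range (e p)" unfolding L by (rule Max_in) auto
  then obtain m where m: "m \<in> I1" "e p m = L" using I1 by auto
  have le_L: "e p i \<le> L" for i unfolding L by simp
  have lower: "L \<le> erasure_error ip f g" if "K_dual smul ip K f g" for g
  proof -
    have "g m = p m" by (rule K_dual_eq_on_independent_part[OF ind disj that p m(1)])
    then have "L = e g m" using m(2) by (simp add: e_def)
    then show ?thesis unfolding err by simp
  qed
  have Inf: "Inf {erasure_error ip f h | h. K_dual smul ip K f h} = L"
    using p lower by (intro cInf_eq_minimum) (auto simp: err L)
  have optimal_iff: "one_erasure_optimal smul ip K f g \<longleftrightarrow>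
      K_dual smul ip K f g \<and> (\<forall>i. e g i \<le> L)" for g
  proof -
    have "one_erasure_optimal smul ip K f g \<longleftrightarrow> K_dual smul ip K f g \<and> Max (range (e g)) = L"
      using Inf by (simp add: one_erasure_optimal_def err)
    also have "\<dots> \<longleftrightarrow> K_dual smul ip K f g \<and> Max (range (e g)) \<le> L"
      using lower[of g] unfolding err by (meson order_antisym order_refl)
    finally show ?thesis by simp
  qed
  have "uncountable {g. one_erasure_optimal smul ip K f g}" if "N > n"
  proof -
    have "dim (UNIV :: 'a set) < CARD('i)" using assms(2,4) that by simp
    then obtain c j where rel: "(\<Sum>i\<in>UNIV. smul (c i) (f i)) = 0" and cj: "c j \<noteq> 0"
      by (rule exists_relation_of_card_gt_dim)
    have c0: "c i = 0" if "i \<in> I1" for i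
      by (rule relation_zero_on_independent_part[OF ind disj rel that])
    have "\<exists>v::'a. v \<noteq> 0"
    proof (rule ccontr)
      assume "\<nexists>v::'a. v \<noteq> 0"
      then have "(UNIV :: 'a set) = span {}" by auto
      then show False using assms(2,3) dim_span_eq_card_independent[OF independent_empty] by simp
    qed
    then obtain v :: 'a where v: "v \<noteq> 0" by blast
    define q where "q t i = p i + smul (of_real t) (smul (conjugate (c i)) v)" for t i
    have dual: "K_dual smul ip K f (q t)" for t
    proof -
      have "q t = (\<lambda>i. p i + smul (conjugate (c i)) (smul (of_real t) v))"
        by (simp add: q_def fun_eq_iff mult.commute)
      then show ?thesis using K_dual_perturb[OF p rel] by (simp only:)
    qed
    have "eventually (\<lambda>t. e (q t) i \<le> L) (at_right 0)" for i
    proof (cases "i \<in> I1")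
      case True
      then show ?thesis using c0 le_L by (simp add: q_def e_def)
    next
      case False
      then have "e p i < L" using le_L[of i] I1 by auto
      moreover have "((\<lambda>t. e (q t) i) \<longlongrightarrow> e p i) (at_right 0)"
        unfolding e_def q_def by (intro tendsto_mult_left ip_norm_add_scale_tendsto)
      ultimately have "eventually (\<lambda>t. e (q t) i < L) (at_right 0)"
        by (rule order_tendstoD(2)[rotated])
      then show ?thesis by eventually_elim simp
    qed
    then have "eventually (\<lambda>t. \<forall>i. e (q t) i \<le> L) (at_right 0)"
      by (rule eventually_all_finite)
    then obtain b where b: "b > 0" "\<And>t. 0 < t \<Longrightarrow> t < b \<Longrightarrow> \<forall>i. e (q t) i \<le> L"
      by (auto simp: eventually_at_right_field)
    have "q ` {0<..<b} \<subseteq> {g. one_erasure_optimal smul ip K f g}"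
      using b dual by (auto simp: optimal_iff)
    moreover have "inj_on q {0<..<b}"
    proof (rule inj_onI)
      fix s t assume "q s = q t"
      then have "q s j = q t j" by simp
      then show "s = t" using v cj by (simp add: q_def)
    qed
    then have "uncountable (q ` {0<..<b})"
      using uncountable_open_interval[of 0 b] b(1) countable_image_inj_on by blast
    ultimately show ?thesis using countable_subset by blast
  qed
  moreover have "one_erasure_optimal smul ip K f p"
    using p le_L by (simp add: optimal_iff)
  ultimately show ?thesis by (simp add: p_def)
qed

end
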